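(* Let $\varphi:\mathbb{D}\to\mathbb{C}$ be a Ma–Minda function with expansion $\varphi(z)=1+B_1z+B_2z^2+B_3z^3+B_4z^4+\cdots$, $B_1>0$ (so all $B_i$ are real), whose coefficients satisfy all four of the following conditions: (C1) $|B_1^2+2B_2|<2B_1$ (equivalently $|B_1^2+2B_2|^2<4B_1^2$); (C2) $|B_1^3-B_1^2B_2+18B_2^2-18B_1B_3|<3\,|(B_1^2+2B_1+2B_2)(2B_1^2-3B_1+3B_2)|$; (C3) $|N|<8|D|$, where $$\begin{aligned}N={}&30B_1^7-9B_1^8-B_1^6(66B_2-5)-648B_2^3+324B_2^4+B_1^5(170B_2-126)-648B_2B_3^2\\&+B_1^3(-180B_2+220B_2^2+108B_3-360B_2B_3)+B_1(1296B_2B_3-720B_2^2B_3)+648B_2^2B_4\\&+B_1^4(108+10B_2-175B_2^2+90B_3+162B_4)\\&+B_1^2(-144B_2^2+4B_2^3+180B_2B_3-324B_3^2-648B_4+648B_2B_4),\end{aligned}$$ $$\begin{aligned}D={}&9B_1^6+9B_1^7+B_1^4(-27+32B_2)+B_1^5(-52+63B_2)+162B_2^2B_3\\&+B_1^3(81-189B_2+164B_2^2+9B_3)+B_1^2(18B_2^2-9B_2B_3)+B_1(-162B_2^2+198B_2^3-81B_3^2);\end{aligned}$$ (C4) $0<\dfrac{4B_1^2+6(B_2-B_1)}{3B_1^2+6(B_2-B_1)}<1$. If $f(z)=z+\sum_{n=2}^\infty a_nz^n$ belongs to $\mathcal{S}^*(\varphi)$, then $$|a_5|\le \frac{B_1}{4}.$$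 The inequality is sharp: for each such $\varphi$ there is a function in $\mathcal{S}^*(\varphi)$ for which equality holds.
   Context: $\mathbb{D}=\{z\in\mathbb{C}:|z|<1\}$. $\mathcal{A}$ is the class of analytic functions on $\mathbb{D}$ of the form $f(z)=z+\sum_{n=2}^\infty a_nz^n$. A Schwarz function is an analytic $\omega:\mathbb{D}\to\mathbb{D}$ with $\omega(0)=0$. For analytic $f,g$ on $\mathbb{D}$, $f\prec g$ (subordination) means there is a Schwarz function $\omega$ with $f(z)=g(\omega(z))$ for all $z\in\mathbb{D}$. A Ma–Minda function is an analytic univalent function $\varphi$ on $\mathbb{D}$ such that (i) $\operatorname{Re}\varphi(z)>0$ for $z\in\mathbb{D}$; (ii) $\varphi'(0)>0$; (iii) $\varphi(\mathbb{D})$ is a starlike domain with respect to $\varphi(0)=1$; (iv) $\varphi(\mathbb{D})$ is symmetric about the real axis. Then $\overline{\varphi(\bar z)}=\varphi(z)$ and all Taylor coefficients of $\varphi$ are real. $\mathcal{S}^*(\varphi)=\{f\in\mathcal{A}: zf'(z)/f(z)\prec\varphi(z)\}$. *)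

theory Defs
  imports "HOL-Complex_Analysis.Complex_Analysis"
begin

abbreviation unit_disc :: "complex set" where
  "unit_disc \<equiv> ball 0 1"

abbreviation taylor_coeff :: "(complex \<Rightarrow> complex) \<Rightarrow> nat \<Rightarrow> complex" where
  "taylor_coeff f n \<equiv> fps_nth (fps_expansion f 0) n"

(* Functions on the disc are total functions on the complex plane; their values outside
   the unit disc never play a role. *)

definition class_A :: "(complex \<Rightarrow> complex) set" where
  "class_A = {f. f holomorphic_on unit_disc \<and> taylor_coeff f 0 = 0 \<and> taylor_coeff f 1 = 1}"

definition schwarz_function :: "(complex \<Rightarrow> complex) \<Rightarrow> bool" where
  "schwarz_function \<omega> \<longleftrightarrow>
     \<omega> holomorphic_on unit_disc \<and> \<omega> ` unit_disc \<subseteq> unit_disc \<and> \<omega> 0 = 0"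

definition subordinate :: "(complex \<Rightarrow> complex) \<Rightarrow> (complex \<Rightarrow> complex) \<Rightarrow> bool" where
  "subordinate f g \<longleftrightarrow>
     f holomorphic_on unit_disc \<and> g holomorphic_on unit_disc \<and>
     (\<exists>\<omega>. schwarz_function \<omega> \<and> (\<forall>z\<in>unit_disc. f z = g (\<omega> z)))"

(* The library predicate "starlike" leaves the star centre existentially quantified, so
   starlikeness with respect to the point 1 is spelled out. *)
definition ma_minda :: "(complex \<Rightarrow> complex) \<Rightarrow> bool" where
  "ma_minda \<phi> \<longleftrightarrow>
     \<phi> holomorphic_on unit_disc \<and> inj_on \<phi> unit_disc \<and>
     (\<forall>z\<in>unit_disc. Re (\<phi> z) > 0) \<and>
     deriv \<phi> 0 \<in> \<real> \<and> Re (deriv \<phi> 0) > 0 \<and>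
     \<phi> 0 = 1 \<and> (\<forall>w\<in>\<phi> ` unit_disc. closed_segment 1 w \<subseteq> \<phi> ` unit_disc) \<and>
     cnj ` (\<phi> ` unit_disc) = \<phi> ` unit_disc"

(* The quotient z f'(z) / f(z) has a removable singularity at 0 with value 1 for f in
   class A. Its analyticity on the disc forces f to have no zero other than 0; this is
   required explicitly because HOL division by zero yields 0. *)
definition S_star :: "(complex \<Rightarrow> complex) \<Rightarrow> (complex \<Rightarrow> complex) set" where
  "S_star \<phi> = {f \<in> class_A.
     (\<forall>z\<in>unit_disc - {0}. f z \<noteq> 0) \<and>
     subordinate (\<lambda>z. if z = 0 then 1 else z * deriv f z / f z) \<phi>}"

definition N_poly :: "real \<Rightarrow> real \<Rightarrow> real \<Rightarrow> real \<Rightarrow> real" where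
  "N_poly B1 B2 B3 B4 =
     30*B1^7 - 9*B1^8 - B1^6*(66*B2 - 5) - 648*B2^3 + 324*B2^4 + B1^5*(170*B2 - 126)
     - 648*B2*B3^2
     + B1^3*(- 180*B2 + 220*B2^2 + 108*B3 - 360*B2*B3)
     + B1*(1296*B2*B3 - 720*B2^2*B3) + 648*B2^2*B4
     + B1^4*(108 + 10*B2 - 175*B2^2 + 90*B3 + 162*B4)
     + B1^2*(- 144*B2^2 + 4*B2^3 + 180*B2*B3 - 324*B3^2 - 648*B4 + 648*B2*B4)"

definition D_poly :: "real \<Rightarrow> real \<Rightarrow> real \<Rightarrow> real" where
  "D_poly B1 B2 B3 =
     9*B1^6 + 9*B1^7 + B1^4*(- 27 + 32*B2) + B1^5*(- 52 + 63*B2) + 162*B2^2*B3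
     + B1^3*(81 - 189*B2 + 164*B2^2 + 9*B3) + B1^2*(18*B2^2 - 9*B2*B3)
     + B1*(- 162*B2^2 + 198*B2^3 - 81*B3^2)"

lemma ma_minda_cnj:
  assumes "ma_minda \<phi>" "z \<in> unit_disc"
  shows "cnj (\<phi> (cnj z)) = \<phi> z"
proof -
  have hol: "\<phi> holomorphic_on unit_disc" and inj: "inj_on \<phi> unit_disc"
    and d0: "deriv \<phi> 0 \<in> \<real>" "Re (deriv \<phi> 0) > 0" and p0: "\<phi> 0 = 1"
    and sym: "cnj ` (\<phi> ` unit_disc) = \<phi> ` unit_disc"
    using assms by (auto simp: ma_minda_def)
  obtain h where h: "h holomorphic_on \<phi> ` unit_disc"
    "\<And>z. z \<in> unit_disc \<Longrightarrow> deriv \<phi> z * deriv h (\<phi> z) = 1"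
    "\<And>z. z \<in> unit_disc \<Longrightarrow> h (\<phi> z) = z"
    using holomorphic_has_inverse[OF hol _ inj] by auto
  define g where "g = cnj \<circ> \<phi> \<circ> cnj"
  have cnjD: "cnj ` unit_disc = unit_disc"
    by (force simp: image_iff dist_norm intro: bexI[of _ "cnj _"])
  have holg: "g holomorphic_on unit_disc"
    unfolding g_def using holomorphic_on_compose_cnj_cnj[of \<phi> unit_disc] hol cnjD by simp
  have gim: "g w \<in> \<phi> ` unit_disc" if "w \<in> unit_disc" for w
    using that sym cnjD unfolding g_def by auto
  have holhg: "(h \<circ> g) holomorphic_on unit_disc"
    using gim by (intro holomorphic_on_compose_gen[OF holg h(1)]) auto
  have bound: "norm ((h \<circ> g) w) < 1" if "norm w < 1" for w
    using gim[of w] that h(3) by fastforce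
  have D\<phi>: "(\<phi> has_field_derivative deriv \<phi> 0) (at 0)"
    using hol by (intro holomorphic_derivI[of _ unit_disc]) auto
  have Dg: "(g has_field_derivative deriv \<phi> 0) (at 0)"
    using has_field_derivative_cnj_cnj[of \<phi> "deriv \<phi> 0" 0] D\<phi> d0
    by (simp add: g_def Reals_cnj_iff)
  have op: "open (\<phi> ` unit_disc)"
    using open_mapping_thm3[OF hol _ inj] by simp
  have g0: "g 0 = 1" by (simp add: g_def p0)
  have Dh: "(h has_field_derivative deriv h 1) (at (g 0))"
    unfolding g0 using h(1) op p0
    by (intro holomorphic_derivI[of _ "\<phi> ` unit_disc"]) (auto simp: image_iff intro: bexI[of _ 0])
  have dhg: "deriv (h \<circ> g) 0 = 1"
    using DERIV_imp_deriv[OF DERIV_chain[OF Dh Dg]] h(2)[of 0] p0 by (simp add: mult.commute)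
  have hg0: "(h \<circ> g) 0 = 0"
    using h(3)[of 0] p0 g0 by simp
  obtain \<alpha> where \<alpha>: "\<And>z. norm z < 1 \<Longrightarrow> (h \<circ> g) z = \<alpha> * z"
    using Schwarz_Lemma(3)[OF holhg hg0 bound, of 0] dhg by (metis norm_one norm_zero zero_less_one)
  have "eventually (\<lambda>z. (h \<circ> g) z = \<alpha> * z) (nhds 0)"
    using eventually_nhds_in_open[of unit_disc 0] \<alpha> by (auto elim!: eventually_mono)
  hence "deriv (h \<circ> g) 0 = deriv (\<lambda>z. \<alpha> * z) 0"
    by (intro deriv_cong_ev) auto
  hence "\<alpha> = 1" using dhg by simp
  hence "h (g z) = z" using \<alpha>[of z] assms(2) by simp
  moreover obtain w where "w \<in> unit_disc" "g z = \<phi> w" using gim[OF assms(2)] by auto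
  ultimately have "g z = \<phi> z" using h(3)[of w] by simp
  thus ?thesis by (simp add: g_def)
qed

lemma ma_minda_taylor_coeff_real:
  assumes "ma_minda \<phi>"
  shows "of_real (Re (taylor_coeff \<phi> n)) = taylor_coeff \<phi> n"
proof -
  have hol: "\<phi> holomorphic_on unit_disc"
    using assms by (auto simp: ma_minda_def)
  have "\<forall>z\<in>unit_disc. cnj ((deriv ^^ n) \<phi> (cnj z)) = (deriv ^^ n) \<phi> z"
  proof (induction n)
    case 0
    thus ?case using ma_minda_cnj[OF assms] by auto
  next
    case (Suc n)
    show ?case
    proof
      fix z assume z: "z \<in> unit_disc"
      let ?F = "(deriv ^^ n) \<phi>"
      have "(?F has_field_derivative deriv ?F (cnj z)) (at (cnj z))"
        using z by (intro holomorphic_derivI[OF holomorphic_higher_deriv[OF hol]]) auto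
      hence "(cnj \<circ> ?F \<circ> cnj has_field_derivative cnj (deriv ?F (cnj z))) (at z)"
        using has_field_derivative_cnj_cnj[of ?F _ z] by simp
      moreover have "eventually (\<lambda>w. (cnj \<circ> ?F \<circ> cnj) w = ?F w) (nhds z)"
        using eventually_nhds_in_open[of unit_disc z] z
        by (auto elim!: eventually_mono simp: Suc)
      ultimately show "cnj ((deriv ^^ Suc n) \<phi> (cnj z)) = (deriv ^^ Suc n) \<phi> z"
        using deriv_cong_ev[of "cnj \<circ> ?F \<circ> cnj" ?F z z] DERIV_imp_deriv by fastforce
    qed
  qed
  from bspec[OF this, of 0] have "cnj (taylor_coeff \<phi> n) = taylor_coeff \<phi> n"
    by (simp add: fps_expansion_def)
  thus ?thesis by (simp add: Reals_cnj_iff)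
qed

end

theory Submission
  imports Defs
begin

text \<open>Writing \<open>z f'(z) / f(z) = \<phi>(\<omega>(z))\<close>, the number \<open>4 a\<^sub>5 / B\<^sub>1\<close> is a polynomial in the
  coefficients \<open>c\<^sub>1, \<dots>, c\<^sub>4\<close> of \<open>\<omega>\<close> with leading term \<open>c\<^sub>4\<close>. It is realised as the fourth coefficient of
  \<open>W / (1 - W V)\<close>, where \<open>W\<close> is the Schwarz function obtained from \<open>(1 + \<omega>) / (1 - \<omega>)\<close> by damping its odd part
  by a factor \<open>s\<close>, and \<open>V = S(W)\<close> for a function \<open>S\<close> in the Schur class with Schur parameters
  \<open>z\<^sub>0, z\<^sub>1, z\<^sub>2\<close>. Matching coefficients makes \<open>s\<^sup>2\<close> the quotient in (C4), \<open>z\<^sub>0 = (B\<^sub>1\<^sup>2 + 2 B\<^sub>2) / (2 B\<^sub>1)\<close>, \<open>z\<^sub>1\<close> the quotient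
  of the two sides of (C2) and \<open>z\<^sub>2 = - N / (8 D)\<close>, so that the hypotheses say exactly that these
  parameters are admissible. Finally, every coefficient of \<open>W / (1 - W V)\<close> is at most 1 in modulus, because
  multiplication by Schur functions contracts partial square sums of coefficients. Equality holds for
  \<open>\<omega>(z) = z\<^sup>4\<close>.\<close>

section \<open>Power series of functions bounded by 1 on the disc\<close>

lemma has_fps_expansion_disc:
  assumes "f holomorphic_on unit_disc"
  shows "f has_fps_expansion fps_expansion f 0"
  by (rule has_fps_expansion_fps_expansion[OF open_ball _ assms]) simp

lemma has_fps_expansion_eqI_disc:
  assumes "f has_fps_expansion F" "g has_fps_expansion G"
    and "\<And>z::complex. z \<in> unit_disc \<Longrightarrow> f z = g z"
  shows "F = G"
proof -
  have "eventually (\<lambda>z. f z = g z) (nhds 0)"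
    using eventually_nhds_in_open[of unit_disc 0] by (auto elim!: eventually_mono simp: assms(3))
  hence "f has_fps_expansion G"
    using assms(2) has_fps_expansion_cong by blast
  thus ?thesis using assms(1) fps_expansion_unique_complex by blast
qed

text \<open>The Schur class, encoded as a property of series so that coefficient computations take
  place in the ring \<open>complex fps\<close>. The bound is not strict: unimodular constants must
  belong, since dividing \<open>fps_X\<close> by itself already produces one.\<close>

definition schur_series :: "complex fps \<Rightarrow> bool" where
  "schur_series F \<longleftrightarrow>
     (\<exists>f. f holomorphic_on unit_disc \<and> (\<forall>z\<in>unit_disc. norm (f z) \<le> 1) \<and> f has_fps_expansion F)"

lemma schur_seriesI:
  assumes "f holomorphic_on unit_disc" "\<And>z. z \<in> unit_disc \<Longrightarrow> norm (f z) \<le> 1"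
    and "f has_fps_expansion F"
  shows "schur_series F"
  using assms unfolding schur_series_def by blast

lemma schur_series_const: "norm c \<le> 1 \<Longrightarrow> schur_series (fps_const c)"
  by (rule schur_seriesI[of "\<lambda>_. c"]) auto

lemma schur_series_mult:
  assumes "schur_series F" "schur_series G"
  shows "schur_series (F * G)"
proof -
  obtain f g where "f holomorphic_on unit_disc" "\<forall>z\<in>unit_disc. norm (f z) \<le> 1"
      "f has_fps_expansion F" "g holomorphic_on unit_disc"
      "\<forall>z\<in>unit_disc. norm (g z) \<le> 1" "g has_fps_expansion G"
    using assms unfolding schur_series_def by blast
  thus ?thesis
    by (intro schur_seriesI[of "\<lambda>z. f z * g z"])
       (auto intro: holomorphic_intros has_fps_expansion_mult simp: norm_mult mult_le_one)
qed

text \<open>By the maximum modulus principle, modulus 1 at an interior point forces a constant.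
  Splitting this case off supplies the strict bound required by the Schwarz lemma and by the map
  \<open>w / (1 - w)\<close>.\<close>

lemma schur_series_cases:
  assumes "schur_series F"
  obtains (const) c where "norm c = 1" "F = fps_const c"
  | (strict) f where "f holomorphic_on unit_disc" "\<And>z. z \<in> unit_disc \<Longrightarrow> norm (f z) < 1"
      "f has_fps_expansion F"
proof -
  obtain f where f: "f holomorphic_on unit_disc" "\<And>z. z \<in> unit_disc \<Longrightarrow> norm (f z) \<le> 1"
      "f has_fps_expansion F"
    using assms unfolding schur_series_def by blast
  show thesis
  proof (cases "\<forall>z\<in>unit_disc. norm (f z) < 1")
    case True
    thus thesis using strict f by blast
  next
    case False
    then obtain \<xi> where \<xi>: "\<xi> \<in> unit_disc" "norm (f \<xi>) = 1"
      using f(2) by force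
    have "f constant_on unit_disc"
      using f \<xi> by (intro maximum_modulus_principle[of f unit_disc unit_disc \<xi>]) auto
    hence eq: "f z = f \<xi>" if "z \<in> unit_disc" for z
      using that \<xi>(1) by (auto simp: constant_on_def)
    have "F = fps_const (f \<xi>)"
      by (rule has_fps_expansion_eqI_disc[OF f(3) has_fps_expansion_const eq])
    thus thesis using const \<xi> by blast
  qed
qed

text \<open>The Schwarz lemma bounds the quotient \<open>f z / z\<close> off 0 and its value
  \<open>deriv f 0\<close> at 0.\<close>

lemma schur_series_divide_X:
  assumes "schur_series F" "fps_nth F 0 = 0"
  obtains G where "schur_series G" "F = fps_X * G"
  using assms(1)
proof (cases rule: schur_series_cases)
  case (const c)
  thus thesis using assms(2) by auto
next
  case (strict f)
  have f0: "f 0 = 0"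
    using has_fps_expansion_imp_0_eq_fps_nth_0[OF strict(3)] assms(2) by simp
  obtain h where h: "h holomorphic_on unit_disc" "\<And>z. norm z < 1 \<Longrightarrow> f z = z * h z" "deriv f 0 = h 0"
    using Schwarz3[OF strict(1) f0] by blast
  have bound: "norm (h z) \<le> 1" if "z \<in> unit_disc" for z
  proof (cases "z = 0")
    case True
    thus ?thesis
      using Schwarz_Lemma(2)[OF strict(1) f0 strict(2), of 0] h(3) by simp
  next
    case False
    have "norm z * norm (h z) \<le> norm z * 1"
      using Schwarz_Lemma(1)[OF strict(1) f0 strict(2), of z] h(2)[of z] that
      by (simp add: norm_mult)
    thus ?thesis using False by simp
  qed
  have e: "(\<lambda>z. z * h z) has_fps_expansion fps_X * fps_expansion h 0"
    by (intro has_fps_expansion_mult has_fps_expansion_fps_X has_fps_expansion_disc h(1))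
  have "F = fps_X * fps_expansion h 0"
    by (rule has_fps_expansion_eqI_disc[OF strict(3) e]) (simp add: h(2))
  moreover have "schur_series (fps_expansion h 0)"
    using schur_seriesI[OF h(1) bound has_fps_expansion_disc[OF h(1)]] by simp
  ultimately show thesis using that by blast
qed

section \<open>Moebius maps of the disc\<close>

lemma one_plus_cnj_mult_nonzero:
  assumes "norm a < 1" "norm w \<le> 1"
  shows "1 + cnj a * w \<noteq> 0"
proof
  assume "1 + cnj a * w = 0"
  hence "cnj a * w = - 1" by (rule add_eq_0_iff[THEN iffD1])
  hence "norm (cnj a * w) = norm (- 1 :: complex)" by (rule arg_cong)
  hence "norm a * norm w = 1" by (simp add: norm_mult)
  moreover have "norm a * norm w \<le> norm a * 1"
    using assms by (intro mult_left_mono) auto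
  ultimately show False using assms by simp
qed

text \<open>Writing squared norms as \<open>z * cnj z\<close>, the mixed terms cancel. The
  homogeneous form serves twice: \<open>p = 1\<close> bounds Moebius maps, and summation over
  coefficient pairs gives the contraction of partial square sums.\<close>

lemma norm_moebius_pair:
  "(norm (p + cnj a * q))\<^sup>2 - (norm (a * p + q))\<^sup>2 = (1 - (norm a)\<^sup>2) * ((norm p)\<^sup>2 - (norm q)\<^sup>2)"
proof -
  have "complex_of_real ((norm (p + cnj a * q))\<^sup>2 - (norm (a * p + q))\<^sup>2)
       = complex_of_real ((1 - (norm a)\<^sup>2) * ((norm p)\<^sup>2 - (norm q)\<^sup>2))"
    unfolding of_real_diff of_real_mult complex_norm_square by (simp add: algebra_simps)
  thus ?thesis by (simp only: of_real_eq_iff)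
qed

lemma norm_moebius_le_1:
  assumes "norm a < 1" "norm w \<le> 1"
  shows "norm ((a + w) / (1 + cnj a * w)) \<le> 1"
proof -
  have "0 \<le> (1 - (norm a)\<^sup>2) * (1 - (norm w)\<^sup>2)"
    using assms(1,2) by (intro mult_nonneg_nonneg) (simp_all add: power_le_one)
  hence "(norm (a + w))\<^sup>2 \<le> (norm (1 + cnj a * w))\<^sup>2" using norm_moebius_pair[of 1 a w]
    by (simp only: mult_1_right norm_one power_one)
  hence "norm (a + w) \<le> norm (1 + cnj a * w)"
    by (rule power2_le_imp_le) simp
  thus ?thesis
    by (simp add: norm_divide divide_le_eq_1)
qed

text \<open>The conclusion is multiplied out, so that comparing coefficients gives recursions for
  \<open>G\<close> directly.\<close>

lemma schur_series_moebius:
  assumes "schur_series F" "norm a < 1"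
  obtains G where "schur_series G" "G * (1 + fps_const (cnj a) * F) = fps_const a + F"
proof -
  obtain f where f: "f holomorphic_on unit_disc" "\<And>z. z \<in> unit_disc \<Longrightarrow> norm (f z) \<le> 1"
      "f has_fps_expansion F"
    using assms unfolding schur_series_def by blast
  define g where "g z = (a + f z) / (1 + cnj a * f z)" for z
  have nz: "1 + cnj a * f z \<noteq> 0" if "z \<in> unit_disc" for z
    using one_plus_cnj_mult_nonzero[OF assms(2) f(2)[OF that]] .
  have g: "g holomorphic_on unit_disc"
    unfolding g_def using nz by (intro holomorphic_intros f) auto
  have "norm (g z) \<le> 1" if "z \<in> unit_disc" for z
    unfolding g_def using norm_moebius_le_1[OF assms(2) f(2)[OF that]] .
  hence schur: "schur_series (fps_expansion g 0)"
    by (rule schur_seriesI[OF g _ has_fps_expansion_disc[OF g]])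
  have "(\<lambda>z. g z * (1 + cnj a * f z)) has_fps_expansion
          fps_expansion g 0 * (1 + fps_const (cnj a) * F)"
    by (intro fps_expansion_intros has_fps_expansion_disc g f)
  moreover have "(\<lambda>z. a + f z) has_fps_expansion fps_const a + F"
    by (intro fps_expansion_intros f)
  ultimately have "fps_expansion g 0 * (1 + fps_const (cnj a) * F) = fps_const a + F"
    by (rule has_fps_expansion_eqI_disc) (simp add: g_def nz)
  with schur show thesis by (rule that)
qed

section \<open>Schur's algorithm and coefficient bounds\<close>

text \<open>One step of Schur's algorithm: with \<open>a\<close> the constant term, the Moebius map
  with parameter \<open>-a\<close> kills that term, a factor \<open>fps_X\<close> splits off, and
  the relation is solved back for \<open>F\<close>.\<close>

lemma schur_series_decompose:
  assumes "schur_series F" "norm (fps_nth F 0) \<noteq> 1"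
  obtains G where "schur_series G" "norm (fps_nth F 0) < 1"
    "F * (1 + fps_const (cnj (fps_nth F 0)) * (fps_X * G)) = fps_const (fps_nth F 0) + fps_X * G"
proof -
  obtain f where f: "f holomorphic_on unit_disc" "\<And>z. z \<in> unit_disc \<Longrightarrow> norm (f z) \<le> 1"
      "f has_fps_expansion F"
    using assms unfolding schur_series_def by blast
  define a where "a = fps_nth F 0"
  have "norm (f 0) \<le> 1" using f(2)[of 0] by simp
  hence a: "norm a < 1"
    using has_fps_expansion_imp_0_eq_fps_nth_0[OF f(3)] assms(2) by (simp add: a_def)
  obtain H where H: "schur_series H" "H * (1 + fps_const (cnj (-a)) * F) = fps_const (-a) + F"
    using schur_series_moebius[OF assms(1), of "-a"] a by auto
  have "fps_nth (H * (1 + fps_const (cnj (-a)) * F)) 0 = 0"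
    unfolding H(2) by (simp add: a_def)
  hence "fps_nth H 0 * (1 - cnj a * a) = 0"
    by (simp add: a_def)
  moreover have "1 - cnj a * a \<noteq> 0"
    using one_plus_cnj_mult_nonzero[OF a, of "-a"] a by simp
  ultimately have "fps_nth H 0 = 0" by simp
  then obtain G where G: "schur_series G" "H = fps_X * G"
    using schur_series_divide_X[OF H(1)] by blast
  have "F * (1 + fps_const (cnj a) * H) = fps_const a + H"
    using H(2) by (simp add: algebra_simps flip: fps_const_neg)
  thus thesis using that G a unfolding a_def by blast
qed

text \<open>Schur's algorithm: with \<open>a = F(0)\<close> and \<open>u = x / (1 + cnj a X G)\<close>, \<open>v = X G u\<close> one has
  \<open>x = u + cnj a v\<close> and \<open>F x = a u + v\<close>, and the cross terms of the two squares cancel.\<close>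

lemma schur_series_contraction:
  assumes "schur_series F"
  shows "(\<Sum>k\<le>n. (norm (fps_nth (F * x) k))\<^sup>2) \<le> (\<Sum>k\<le>n. (norm (fps_nth x k))\<^sup>2)"
  using assms
proof (induction n arbitrary: F x)
  case 0
  obtain f where f: "\<And>z. z \<in> unit_disc \<Longrightarrow> norm (f z) \<le> 1" "f has_fps_expansion F"
    using 0 unfolding schur_series_def by blast
  hence "norm (fps_nth F 0) \<le> 1"
    using has_fps_expansion_imp_0_eq_fps_nth_0[OF f(2)] f(1)[of 0] by simp
  thus ?case
    by (simp add: norm_mult power_mult_distrib mult_left_le_one_le power_le_one)
next
  case (Suc n)
  show ?case
  proof (cases "norm (fps_nth F 0) = 1")
    case True
    \<comment> \<open>Here \<open>F\<close> is a unimodular constant, and the two sums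
      coincide.\<close>
    from Suc.prems show ?thesis
    proof (cases rule: schur_series_cases)
      case (const c)
      thus ?thesis by (simp add: norm_mult)
    next
      case (strict f)
      thus ?thesis
        using has_fps_expansion_imp_0_eq_fps_nth_0[OF strict(3)] strict(2)[of 0] True by simp
    qed
  next
    case False
    define a where "a = fps_nth F 0"
    obtain G where G: "schur_series G" "norm a < 1"
        "F * (1 + fps_const (cnj a) * (fps_X * G)) = fps_const a + fps_X * G"
      using schur_series_decompose[OF Suc.prems False] unfolding a_def by blast
    define d where "d = 1 + fps_const (cnj a) * (fps_X * G)"
    define u where "u = x * inverse d"
    define v where "v = fps_X * (G * u)"
    have "fps_nth d 0 = 1" by (simp add: d_def)
    hence d1: "d * inverse d = 1" by (simp add: inverse_mult_eq_1')
    have xd: "x = u * d" using d1 by (simp add: u_def mult.assoc mult.commute)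
    hence x: "x = u + fps_const (cnj a) * v" by (simp add: d_def v_def algebra_simps)
    have "F * x = u * (F * d)" by (simp add: xd algebra_simps)
    also have "\<dots> = fps_const a * u + v"
      using G(3) by (simp add: d_def v_def algebra_simps)
    finally have Fx: "F * x = fps_const a * u + v" .
    \<comment> \<open>The factor \<open>fps_X\<close> in \<open>v\<close> shifts indices by one, so
      the induction hypothesis at \<open>n\<close> for \<open>G\<close> and \<open>u\<close>
      suffices.\<close>
    have "(\<Sum>k\<le>Suc n. (norm (fps_nth v k))\<^sup>2) = (\<Sum>k\<le>n. (norm (fps_nth (G * u) k))\<^sup>2)"
      by (subst sum.atMost_Suc_shift) (simp add: v_def)
    also have "\<dots> \<le> (\<Sum>k\<le>n. (norm (fps_nth u k))\<^sup>2)" by (rule Suc.IH[OF G(1)])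
    also have "\<dots> \<le> (\<Sum>k\<le>Suc n. (norm (fps_nth u k))\<^sup>2)" by simp
    finally have uv: "0 \<le> (\<Sum>k\<le>Suc n. (norm (fps_nth u k))\<^sup>2) - (\<Sum>k\<le>Suc n. (norm (fps_nth v k))\<^sup>2)"
      by simp
    have "(\<Sum>k\<le>Suc n. (norm (fps_nth x k))\<^sup>2) - (\<Sum>k\<le>Suc n. (norm (fps_nth (F * x) k))\<^sup>2)
        = (1 - (norm a)\<^sup>2) * ((\<Sum>k\<le>Suc n. (norm (fps_nth u k))\<^sup>2) - (\<Sum>k\<le>Suc n. (norm (fps_nth v k))\<^sup>2))"
      unfolding Fx unfolding x
      by (simp only: fps_add_nth fps_mult_left_const_nth sum_subtractf[symmetric] norm_moebius_pair sum_distrib_left)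
    also have "\<dots> \<ge> 0"
      using uv G(2) by (intro mult_nonneg_nonneg) (auto simp: power_le_one)
    finally show ?thesis by simp
  qed
qed

text \<open>Put \<open>x = 1 + V Z\<close> and \<open>Z = X y\<close>, so that \<open>y = Omega x\<close> with \<open>W = X Omega\<close>. Two contractions give
  \<open>|y|\<^sub>m\<^sup>2 \<le> |x|\<^sub>m\<^sup>2 \<le> 1 + |y|\<^sub>m\<^sub>-\<^sub>1\<^sup>2\<close> for the partial square sums.\<close>

lemma schur_feedback_coeff_le_1:
  assumes W: "schur_series W" "fps_nth W 0 = 0" and V: "schur_series V"
    and Z: "Z = W + W * V * Z"
  shows "norm (fps_nth Z n) \<le> 1"
proof (cases n)
  case 0
  have "fps_nth Z 0 = fps_nth (W + W * V * Z) 0" by (rule arg_cong[OF Z, of "\<lambda>F. fps_nth F 0"])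
  thus ?thesis by (simp add: W(2) 0)
next
  case (Suc m)
  obtain G where G: "schur_series G" "W = fps_X * G"
    using schur_series_divide_X[OF W] by blast
  define x where "x = 1 + V * Z"
  define y where "y = G * x"
  have Zy: "Z = fps_X * y"
    unfolding y_def x_def by (subst Z) (simp add: G(2) algebra_simps)
  have x: "x = 1 + fps_X * (V * y)"
    by (simp add: x_def Zy algebra_simps)
  have "(\<Sum>k\<le>m. (norm (fps_nth y k))\<^sup>2) \<le> (\<Sum>k\<le>m. (norm (fps_nth x k))\<^sup>2)"
    unfolding y_def by (rule schur_series_contraction[OF G(1)])
  also have "\<dots> \<le> 1 + (\<Sum>k<m. (norm (fps_nth y k))\<^sup>2)"
  proof (cases m)
    case (Suc l)
    have "(\<Sum>k\<le>Suc l. (norm (fps_nth x k))\<^sup>2) = 1 + (\<Sum>k\<le>l. (norm (fps_nth (V * y) k))\<^sup>2)"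
      by (subst sum.atMost_Suc_shift) (simp add: x)
    also have "\<dots> \<le> 1 + (\<Sum>k\<le>l. (norm (fps_nth y k))\<^sup>2)"
      using schur_series_contraction[OF V] by simp
    finally show ?thesis by (simp add: Suc lessThan_Suc_atMost)
  qed (simp add: x)
  \<comment> \<open>The two partial sums of \<open>y\<close> differ only by the term at
    \<open>m\<close>, which is the coefficient of \<open>Z\<close> at \<open>Suc m\<close>.\<close>
  finally have "(norm (fps_nth y m))\<^sup>2 \<le> 1"
    by (simp flip: lessThan_Suc_atMost)
  thus ?thesis
    by (simp add: Zy Suc abs_square_le_1)
qed

section \<open>Cayley transform between disc and half-plane\<close>

text \<open>The squares of \<open>norm (1 + u)\<close> and \<open>norm u\<close> differ by
  \<open>1 + 2 * Re u\<close>.\<close>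

lemma norm_le_norm_1_plus_iff: "norm u \<le> norm (1 + u) \<longleftrightarrow> - 1 / 2 \<le> Re u"
proof -
  have "norm u \<le> norm (1 + u) \<longleftrightarrow> (norm u)\<^sup>2 \<le> (norm (1 + u))\<^sup>2"
    by (simp add: abs_le_square_iff[symmetric])
  also have "\<dots> \<longleftrightarrow> - 1 / 2 \<le> Re u"
    unfolding cmod_power2 by (auto simp: power2_eq_square algebra_simps)
  finally show ?thesis .
qed

text \<open>The map \<open>u / (1 + u)\<close> inverts \<open>w / (1 - w)\<close> and leads back
  from the half-plane to the disc.\<close>

lemma norm_Cayley_le_1:
  assumes "- 1 / 2 \<le> Re u"
  shows "1 + u \<noteq> 0" "norm (u / (1 + u)) \<le> 1"
proof -
  have "Re (1 + u) > 0" using assms by simp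
  thus nz: "1 + u \<noteq> 0" by (metis less_irrefl zero_complex.sel(1))
  show "norm (u / (1 + u)) \<le> 1"
    using assms nz unfolding norm_divide by (simp add: norm_le_norm_1_plus_iff divide_le_eq_1)
qed

text \<open>With \<open>P = F / (1 - F)\<close> the function \<open>1 + 2 P\<close> has positive real part; averaging \<open>P(z)\<close> and
  \<open>P(-z)\<close> with weights \<open>(1 + s) / 2\<close> and \<open>(1 - s) / 2\<close> damps the odd coefficients by \<open>s\<close>.\<close>

lemma schur_series_damp_odd:
  assumes F: "schur_series F" "fps_nth F 0 = 0" and s: "0 \<le> s" "s \<le> 1"
  obtains P W where "schur_series W" "P * (1 - F) = F"
    "W * (1 + Abs_fps (\<lambda>n. (if even n then 1 else of_real s) * fps_nth P n))
       = Abs_fps (\<lambda>n. (if even n then 1 else of_real s) * fps_nth P n)"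
  using F(1)
proof (cases rule: schur_series_cases)
  case (const c)
  thus thesis using F(2) by auto
next
  case (strict f)
  have nz: "1 - f z \<noteq> 0" if "z \<in> unit_disc" for z
    using strict(2)[OF that] by auto
  define p where "p z = f z / (1 - f z)" for z
  define q where "q z = of_real ((1 + s) / 2) * p z + of_real ((1 - s) / 2) * p (- z)" for z
  define P where "P = fps_expansion p 0"
  define Q where "Q = Abs_fps (\<lambda>n. (if even n then 1 else of_real s) * fps_nth P n)"
  have hp: "p holomorphic_on unit_disc"
    unfolding p_def using nz by (intro holomorphic_intros strict(1)) auto
  hence eP: "p has_fps_expansion P" unfolding P_def by (rule has_fps_expansion_disc)
  have "(p \<circ> uminus) holomorphic_on unit_disc"
    by (rule holomorphic_on_compose_gen[OF _ hp]) (auto intro: holomorphic_intros)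
  hence hp': "(\<lambda>z. p (- z)) holomorphic_on unit_disc" by (simp add: o_def)
  have "uminus has_fps_expansion (- fps_X :: complex fps)"
    by (intro fps_expansion_intros)
  hence "(p \<circ> uminus) has_fps_expansion fps_compose P (- fps_X)"
    by (intro has_fps_expansion_compose eP) simp_all
  hence eP': "(\<lambda>z. p (- z)) has_fps_expansion Abs_fps (\<lambda>n. (- 1) ^ n * fps_nth P n)"
    by (simp add: o_def fps_compose_uminus')
  have "q has_fps_expansion fps_const (of_real ((1 + s) / 2)) * P
          + fps_const (of_real ((1 - s) / 2)) * Abs_fps (\<lambda>n. (- 1) ^ n * fps_nth P n)"
    unfolding q_def by (intro fps_expansion_intros eP eP')
  also have "fps_const (of_real ((1 + s) / 2)) * P
          + fps_const (of_real ((1 - s) / 2)) * Abs_fps (\<lambda>n. (- 1) ^ n * fps_nth P n) = Q"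
    by (simp add: fps_eq_iff Q_def field_simps)
  finally have eQ: "q has_fps_expansion Q" .
  have Rep: "- 1 / 2 \<le> Re (p z)" if "z \<in> unit_disc" for z
  proof -
    have "1 + p z = 1 / (1 - f z)" using nz[OF that] by (simp add: p_def field_simps)
    hence "norm (p z) = norm (f z) * norm (1 + p z)"
      by (simp add: p_def norm_divide)
    also have "\<dots> \<le> norm (1 + p z)"
      using strict(2)[OF that] by (intro mult_left_le_one_le) auto
    finally show ?thesis by (simp only: norm_le_norm_1_plus_iff)
  qed
  \<comment> \<open>The half-plane is convex, and for \<open>s\<close> in the given range the two
    weights are nonnegative with sum 1.\<close>
  have Req: "- 1 / 2 \<le> Re (q z)" if "z \<in> unit_disc" for z
  proof -
    have "(1 + s) / 2 * (- 1 / 2) + (1 - s) / 2 * (- 1 / 2)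
            \<le> (1 + s) / 2 * Re (p z) + (1 - s) / 2 * Re (p (- z))"
      using s that by (intro add_mono mult_left_mono Rep) auto
    thus ?thesis by (simp add: q_def field_simps)
  qed
  define w where "w z = q z / (1 + q z)" for z
  have hw: "w holomorphic_on unit_disc"
    unfolding w_def q_def using norm_Cayley_le_1(1)[OF Req]
    by (intro holomorphic_intros hp hp') (auto simp: q_def)
  have W: "schur_series (fps_expansion w 0)"
    using norm_Cayley_le_1(2)[OF Req]
    by (intro schur_seriesI[OF hw _ has_fps_expansion_disc[OF hw]]) (auto simp: w_def)
  have "(\<lambda>z. w z * (1 + q z)) has_fps_expansion fps_expansion w 0 * (1 + Q)"
    by (intro fps_expansion_intros has_fps_expansion_disc hw eQ)
  hence "fps_expansion w 0 * (1 + Q) = Q"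
    using eQ by (rule has_fps_expansion_eqI_disc)
       (use norm_Cayley_le_1(1)[OF Req] in \<open>auto simp: w_def\<close>)
  moreover have "(\<lambda>z. p z * (1 - f z)) has_fps_expansion P * (1 - F)"
    by (intro fps_expansion_intros eP strict)
  hence "P * (1 - F) = F"
    using strict(3) by (rule has_fps_expansion_eqI_disc) (use nz in \<open>auto simp: p_def\<close>)
  ultimately show thesis using that W unfolding Q_def by blast
qed

section \<open>The bound for a quartic polynomial in the coefficients\<close>

text \<open>If \<open>S\<close> has Schur parameters \<open>z0\<close>, \<open>z1\<close>,
  \<open>z2\<close>, then \<open>w / (1 - w * S w)\<close> starts with
  \<open>w + z0 * w^2 + g3 * w^3 + g4 * w^4\<close>. The expression in the conclusion is the fourth
  coefficient of this series at \<open>w = W\<close>, where \<open>W\<close> is \<open>F\<close>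
  with the odd part of \<open>F / (1 - F)\<close> damped by \<open>s\<close>.\<close>

lemma schur_fourth_coeff_bound:
  fixes s z0 z1 z2 :: real
  defines "g3 \<equiv> z0^2 + (1 - z0^2) * z1"
  defines "g4 \<equiv> z0^3 + 2 * z0 * (1 - z0^2) * z1 + (1 - z0^2) * (z2 * (1 - z1^2) - z0 * z1^2)"
  assumes F: "schur_series F" "fps_nth F 0 = 0" and s: "0 \<le> s" "s \<le> 1"
    and z: "\<bar>z0\<bar> < 1" "\<bar>z1\<bar> < 1" "\<bar>z2\<bar> < 1"
  shows "norm (fps_nth F 4
      + of_real (2 - 2 * (1 - z0) * s^2) * fps_nth F 1 * fps_nth F 3
      + of_real z0 * (fps_nth F 2)^2
      + of_real (3 - (1 - z0) * (4 * s^2 + 2) + 3 * (1 - 2 * z0 + g3) * s^2) * (fps_nth F 1)^2 * fps_nth F 2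
      + of_real (1 - (1 - z0) * (2 * s^2 + 1) + 3 * (1 - 2 * z0 + g3) * s^2
          - (1 - 3 * z0 + 3 * g3 - g4) * s^4) * (fps_nth F 1)^4) \<le> 1"
proof -
  obtain P W where W: "schur_series W" and P: "P * (1 - F) = F" and
    WQ: "W * (1 + Abs_fps (\<lambda>n. (if even n then 1 else of_real s) * fps_nth P n))
       = Abs_fps (\<lambda>n. (if even n then 1 else of_real s) * fps_nth P n)"
    using schur_series_damp_odd[OF F s] by blast
  \<comment> \<open>Comparing coefficients gives triangular recursions, first for \<open>P\<close>
    in terms of \<open>F\<close> and then for \<open>W\<close> in terms of \<open>Q\<close>, since
    all constant terms vanish.\<close>
  have Pn: "fps_nth P n - fps_nth (P * F) n = fps_nth F n" for n
    using arg_cong[OF P, of "\<lambda>A. fps_nth A n"] by (simp add: algebra_simps)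
  have P0: "fps_nth P 0 = 0" using Pn[of 0] F(2) by simp
  have P1: "fps_nth P 1 = fps_nth F 1"
    using Pn[of 1] F(2) P0 by (simp add: fps_mult_nth numeral_eq_Suc)
  have P2: "fps_nth P 2 = fps_nth F 2 + (fps_nth F 1)^2"
    using Pn[of 2] F(2) P0 P1 by (simp add: fps_mult_nth numeral_eq_Suc algebra_simps)
  have P3: "fps_nth P 3 = fps_nth F 3 + fps_nth P 1 * fps_nth F 2 + fps_nth P 2 * fps_nth F 1"
    using Pn[of 3] F(2) P0 by (simp add: fps_mult_nth numeral_eq_Suc algebra_simps)
  have P4: "fps_nth P 4 = fps_nth F 4 + fps_nth P 1 * fps_nth F 3 + fps_nth P 2 * fps_nth F 2
      + fps_nth P 3 * fps_nth F 1"
    using Pn[of 4] F(2) P0 by (simp add: fps_mult_nth numeral_eq_Suc algebra_simps)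
  define Q where "Q = Abs_fps (\<lambda>n. (if even n then 1 else of_real s) * fps_nth P n)"
  have Q: "fps_nth Q 0 = 0" "fps_nth Q 1 = of_real s * fps_nth P 1" "fps_nth Q 2 = fps_nth P 2"
      "fps_nth Q 3 = of_real s * fps_nth P 3" "fps_nth Q 4 = fps_nth P 4"
    by (simp_all add: Q_def P0)
  have Wn: "fps_nth W n + fps_nth (W * Q) n = fps_nth Q n" for n
    using arg_cong[OF WQ[folded Q_def], of "\<lambda>A. fps_nth A n"] by (simp add: algebra_simps)
  have W0: "fps_nth W 0 = 0" using Wn[of 0] Q(1) by simp
  have W1: "fps_nth W 1 = fps_nth Q 1"
    using Wn[of 1] W0 Q(1) by (simp add: fps_mult_nth numeral_eq_Suc)
  have W2: "fps_nth W 2 = fps_nth Q 2 - fps_nth W 1 * fps_nth Q 1"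
    using Wn[of 2] W0 Q(1) by (simp add: fps_mult_nth numeral_eq_Suc algebra_simps)
  have W3: "fps_nth W 3 = fps_nth Q 3 - fps_nth W 1 * fps_nth Q 2 - fps_nth W 2 * fps_nth Q 1"
    using Wn[of 3] W0 Q(1) by (simp add: fps_mult_nth numeral_eq_Suc algebra_simps)
  have W4: "fps_nth W 4 = fps_nth Q 4 - fps_nth W 1 * fps_nth Q 3 - fps_nth W 2 * fps_nth Q 2
      - fps_nth W 3 * fps_nth Q 1"
    using Wn[of 4] W0 Q(1) by (simp add: fps_mult_nth numeral_eq_Suc algebra_simps)
  \<comment> \<open>Schur's algorithm runs backwards from the constant \<open>z2\<close>, with
    \<open>W\<close> in place of the variable: first \<open>T\<close> with parameter
    \<open>z1\<close>, then \<open>V = S(W)\<close> with parameter \<open>z0\<close>. Real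
    parameters make the conjugations disappear.\<close>
  have "schur_series (fps_const (of_real z2) * W)"
    using z by (intro schur_series_mult schur_series_const W) simp
  then obtain T where T: "schur_series T"
      "T * (1 + fps_const (of_real z1) * (fps_const (of_real z2) * W))
         = fps_const (of_real z1) + fps_const (of_real z2) * W"
    using schur_series_moebius[of "fps_const (of_real z2) * W" "of_real z1"] z
    by (metis complex_cnj_complex_of_real norm_of_real)
  obtain V where V: "schur_series V"
      "V * (1 + fps_const (of_real z0) * (W * T)) = fps_const (of_real z0) + W * T"
    using schur_series_moebius[OF schur_series_mult[OF W T(1)], of "of_real z0"] z
    by (metis complex_cnj_complex_of_real norm_of_real)
  have Tn: "fps_nth T n + of_real (z1 * z2) * fps_nth (T * W) n
      = fps_nth (fps_const (of_real z1)) n + of_real z2 * fps_nth W n" for n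
  proof -
    have "T + fps_const (of_real (z1 * z2)) * (T * W)
        = fps_const (of_real z1) + fps_const (of_real z2) * W"
      using T(2) by (simp add: algebra_simps flip: fps_const_mult)
    from arg_cong[OF this, of "\<lambda>A. fps_nth A n"] show ?thesis
      by (simp only: fps_add_nth fps_mult_left_const_nth)
  qed
  have T0: "fps_nth T 0 = of_real z1" using Tn[of 0] W0 by simp
  have T1: "fps_nth T 1 = of_real (z2 * (1 - z1^2)) * fps_nth W 1"
    using Tn[of 1] W0 T0 by (simp add: fps_mult_nth numeral_eq_Suc algebra_simps)
  define H where "H = W * T"
  have H0: "fps_nth H 0 = 0" by (simp add: H_def W0)
  have H1: "fps_nth H 1 = of_real z1 * fps_nth W 1"
    using W0 T0 by (simp add: H_def fps_mult_nth numeral_eq_Suc)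
  have H2: "fps_nth H 2 = fps_nth W 1 * fps_nth T 1 + fps_nth W 2 * of_real z1"
    using W0 T0 by (simp add: H_def fps_mult_nth numeral_eq_Suc)
  have Vn: "fps_nth V n + of_real z0 * fps_nth (V * H) n
      = fps_nth (fps_const (of_real z0)) n + fps_nth H n" for n
  proof -
    have "V + fps_const (of_real z0) * (V * H) = fps_const (of_real z0) + H"
      using V(2) by (simp add: H_def algebra_simps)
    from arg_cong[OF this, of "\<lambda>A. fps_nth A n"] show ?thesis
      by (simp only: fps_add_nth fps_mult_left_const_nth)
  qed
  have V0: "fps_nth V 0 = of_real z0" using Vn[of 0] H0 by simp
  have V1: "fps_nth V 1 = of_real (1 - z0^2) * fps_nth H 1"
    using Vn[of 1] H0 V0 by (simp add: fps_mult_nth numeral_eq_Suc algebra_simps)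
  have V2: "fps_nth V 2 = of_real (1 - z0^2) * fps_nth H 2 - of_real z0 * fps_nth V 1 * fps_nth H 1"
    using Vn[of 2] H0 V0 by (simp add: fps_mult_nth numeral_eq_Suc algebra_simps)
  define Z where "Z = W * inverse (1 - W * V)"
  have "fps_nth (1 - W * V) 0 = 1" by (simp add: W0)
  hence "inverse (1 - W * V) * (1 - W * V) = 1" by (intro inverse_mult_eq_1) (simp add: W0)
  hence "Z * (1 - W * V) = W" by (simp add: Z_def mult.assoc)
  hence Z: "Z = W + W * V * Z" by (simp add: algebra_simps)
  have Zn: "fps_nth Z n = fps_nth W n + fps_nth (W * (V * Z)) n" for n
    using arg_cong[OF Z, of "\<lambda>A. fps_nth A n"] by (simp add: mult.assoc)
  have Z0: "fps_nth Z 0 = 0" using Zn[of 0] W0 by simp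
  have VZ0: "fps_nth (V * Z) 0 = 0" by (simp add: Z0)
  have VZ1: "fps_nth (V * Z) 1 = fps_nth V 0 * fps_nth Z 1"
    using Z0 by (simp add: fps_mult_nth numeral_eq_Suc)
  have VZ2: "fps_nth (V * Z) 2 = fps_nth V 0 * fps_nth Z 2 + fps_nth V 1 * fps_nth Z 1"
    using Z0 by (simp add: fps_mult_nth numeral_eq_Suc)
  have VZ3: "fps_nth (V * Z) 3 = fps_nth V 0 * fps_nth Z 3 + fps_nth V 1 * fps_nth Z 2
      + fps_nth V 2 * fps_nth Z 1"
    using Z0 by (simp add: fps_mult_nth numeral_eq_Suc)
  have Z1: "fps_nth Z 1 = fps_nth W 1"
    using Zn[of 1] W0 VZ0 by (simp add: fps_mult_nth[of W] numeral_eq_Suc)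
  have Z2: "fps_nth Z 2 = fps_nth W 2 + fps_nth W 1 * fps_nth (V * Z) 1"
    using Zn[of 2] W0 VZ0 by (simp add: fps_mult_nth[of W] numeral_eq_Suc)
  have Z3: "fps_nth Z 3 = fps_nth W 3 + fps_nth W 1 * fps_nth (V * Z) 2 + fps_nth W 2 * fps_nth (V * Z) 1"
    using Zn[of 3] W0 VZ0 by (simp add: fps_mult_nth[of W] numeral_eq_Suc)
  have Z4: "fps_nth Z 4 = fps_nth W 4 + fps_nth W 1 * fps_nth (V * Z) 3
      + fps_nth W 2 * fps_nth (V * Z) 2 + fps_nth W 3 * fps_nth (V * Z) 1"
    using Zn[of 4] W0 VZ0 by (simp add: fps_mult_nth[of W] numeral_eq_Suc)
  \<comment> \<open>The factors beside \<open>z0\<close>, \<open>g3\<close>, \<open>g4\<close> are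
    the fourth coefficients of the powers \<open>W^2\<close>, \<open>W^3\<close>,
    \<open>W^4\<close>.\<close>
  have Z4W: "fps_nth Z 4 = fps_nth W 4 + of_real z0 * (2 * fps_nth W 1 * fps_nth W 3 + (fps_nth W 2)^2)
      + 3 * of_real g3 * (fps_nth W 1)^2 * fps_nth W 2 + of_real g4 * (fps_nth W 1)^4"
    unfolding Z4 VZ3 VZ2 VZ1 Z3 VZ2 VZ1 Z2 VZ1 Z1 V2 V1 V0 H1 H2 T1 g3_def g4_def
      of_real_add of_real_mult of_real_diff of_real_power of_real_1 of_real_numeral
    by algebra
  have "fps_nth Z 4 = fps_nth F 4
      + of_real (2 - 2 * (1 - z0) * s^2) * fps_nth F 1 * fps_nth F 3
      + of_real z0 * (fps_nth F 2)^2
      + of_real (3 - (1 - z0) * (4 * s^2 + 2) + 3 * (1 - 2 * z0 + g3) * s^2) * (fps_nth F 1)^2 * fps_nth F 2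
      + of_real (1 - (1 - z0) * (2 * s^2 + 1) + 3 * (1 - 2 * z0 + g3) * s^2
          - (1 - 3 * z0 + 3 * g3 - g4) * s^4) * (fps_nth F 1)^4"
    unfolding Z4W W4 W3 W2 W1 Q P4 P3 P2 P1
      of_real_add of_real_mult of_real_diff of_real_power of_real_1 of_real_numeral
    by algebra
  moreover have "norm (fps_nth Z 4) \<le> 1"
    by (rule schur_feedback_coeff_le_1[OF W W0 V(1) Z])
  ultimately show ?thesis by simp
qed

section \<open>From the coefficient conditions to the parameters\<close>

text \<open>This is the origin of \<open>D_poly\<close>: with \<open>z1 = X / Y\<close> for the two
  sides of (C2), it equals \<open>Y^2 * (1 - z1^2) / (4 * b)\<close>.\<close>

lemma sq_minus_sq_eq_D_poly:
  "(3 * ((b^2 + 2 * b + 2 * B2) * (2 * b^2 - 3 * b + 3 * B2)))^2 - (b^3 - b^2 * B2 + 18 * B2^2 - 18 * b * B3)^2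
     = 4 * b * D_poly b B2 B3"
  unfolding D_poly_def by algebra

text \<open>\<open>B2\<close> and \<open>B3\<close> are written through the parameters by solving
  the formulas for \<open>z0\<close> and \<open>z1\<close>; the hypothesis on \<open>b\<close>
  encodes the quotient \<open>r\<close> of (C4). The left factor
  \<open>648 * b^2 * (z0^2 - 1)\<close> is the coefficient of \<open>B4\<close> in
  \<open>N_poly\<close>. Hence matching the terms in the fourth power of the first coefficient
  amounts to the vanishing of the right side, which fixes \<open>z2\<close>.\<close>

lemma N_poly_eq:
  fixes b z0 z1 z2 r B4 :: real
  defines "B2 \<equiv> b * z0 - b^2 / 2"
  defines "B3 \<equiv> b * ((b - (b * z0 - b^2 / 2)) / 18 + (z0 - b / 2)^2 + (1 - z0^2) * r * z1)"
  defines "g3 \<equiv> z0^2 + (1 - z0^2) * z1"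
  defines "g4 \<equiv> z0^3 + 2 * z0 * (1 - z0^2) * z1 + (1 - z0^2) * (z2 * (1 - z1^2) - z0 * z1^2)"
  assumes b: "b = 6 * (1 - z0) * (1 - r)"
  shows "648 * b^2 * (z0^2 - 1) * (B4 + 4 / 3 * b * B3 + B2^2 / 2 + b^2 * B2 + b^4 / 6
      - b * (1 - (1 - z0) * (2 * r + 1) + 3 * (1 - 2 * z0 + g3) * r - (1 - 3 * z0 + 3 * g3 - g4) * r^2))
    = N_poly b B2 B3 B4 + 648 * b^3 * (1 - z0^2)^2 * r^2 * (1 - z1^2) * z2"
  unfolding N_poly_def B2_def B3_def g3_def g4_def b
  by algebra

text \<open>The four final equations identify the coefficients of the monomials in
  \<open>fifth_coeff_eq\<close>, apart from the leading one, with \<open>b\<close> times those in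
  \<open>schur_fourth_coeff_bound\<close>.\<close>

lemma schur_parameters_of_coeffs:
  fixes b B2 B3 B4 :: real
  assumes C1: "\<bar>b^2 + 2 * B2\<bar> < 2 * b"
    and C2: "\<bar>b^3 - b^2 * B2 + 18 * B2^2 - 18 * b * B3\<bar>
         < 3 * \<bar>(b^2 + 2 * b + 2 * B2) * (2 * b^2 - 3 * b + 3 * B2)\<bar>"
    and C3: "\<bar>N_poly b B2 B3 B4\<bar> < 8 * \<bar>D_poly b B2 B3\<bar>"
    and C4: "0 < (4 * b^2 + 6 * (B2 - b)) / (3 * b^2 + 6 * (B2 - b))"
      "(4 * b^2 + 6 * (B2 - b)) / (3 * b^2 + 6 * (B2 - b)) < 1"
  obtains s z0 z1 z2 g3 g4 :: real where
    "0 \<le> s" "s \<le> 1" "\<bar>z0\<bar> < 1" "\<bar>z1\<bar> < 1" "\<bar>z2\<bar> < 1"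
    "g3 = z0^2 + (1 - z0^2) * z1"
    "g4 = z0^3 + 2 * z0 * (1 - z0^2) * z1 + (1 - z0^2) * (z2 * (1 - z1^2) - z0 * z1^2)"
    "2 * B2 + 4 / 3 * b^2 = b * (2 - 2 * (1 - z0) * s^2)"
    "B2 + b^2 / 2 = b * z0"
    "3 * B3 + 11 / 3 * b * B2 + b^3
       = b * (3 - (1 - z0) * (4 * s^2 + 2) + 3 * (1 - 2 * z0 + g3) * s^2)"
    "B4 + 4 / 3 * b * B3 + B2^2 / 2 + b^2 * B2 + b^4 / 6
       = b * (1 - (1 - z0) * (2 * s^2 + 1) + 3 * (1 - 2 * z0 + g3) * s^2
          - (1 - 3 * z0 + 3 * g3 - g4) * s^4)"
proof -
  have b: "b > 0" using C1 by linarith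
  define z0 where "z0 = (b^2 + 2 * B2) / (2 * b)"
  define r where "r = (4 * b^2 + 6 * (B2 - b)) / (3 * b^2 + 6 * (B2 - b))"
  define X where "X = b^3 - b^2 * B2 + 18 * B2^2 - 18 * b * B3"
  define Y where "Y = 3 * ((b^2 + 2 * b + 2 * B2) * (2 * b^2 - 3 * b + 3 * B2))"
  define D where "D = D_poly b B2 B3"
  define N where "N = N_poly b B2 B3 B4"
  define z1 where "z1 = X / Y"
  define z2 where "z2 = - N / (8 * D)"
  have r: "0 < r" "r < 1" using C4 by (simp_all add: r_def)
  have z0: "\<bar>z0\<bar> < 1" using C1 b by (simp add: z0_def)
  have XY: "\<bar>X\<bar> < \<bar>Y\<bar>" using C2 by (simp add: X_def Y_def abs_mult)
  have ND: "\<bar>N\<bar> < 8 * \<bar>D\<bar>" using C3 by (simp add: N_def D_def)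
  have z1: "\<bar>z1\<bar> < 1" using XY by (simp add: z1_def)
  have z2: "\<bar>z2\<bar> < 1" using ND by (simp add: z2_def abs_mult)
  \<comment> \<open>The strict inequalities force \<open>Y\<close> and \<open>D\<close> to be
    nonzero, so these quotients can be multiplied out.\<close>
  have X: "X = Y * z1" using XY by (auto simp: z1_def)
  have N: "N = - 8 * D * z2" using ND by (auto simp: z2_def)
  have B2: "B2 = b * z0 - b^2 / 2" using b by (simp add: z0_def field_simps power2_eq_square)
  \<comment> \<open>A zero denominator would give \<open>r = 0\<close> by the convention for
    division, against \<open>0 < r\<close>.\<close>
  have "3 * b^2 + 6 * (B2 - b) \<noteq> 0" using r by (auto simp: r_def)
  hence "r * (3 * b^2 + 6 * (B2 - b)) = 4 * b^2 + 6 * (B2 - b)" by (simp add: r_def)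
  hence "b * (b - 6 * (1 - z0) * (1 - r)) = 0" unfolding B2 by algebra
  hence br: "b = 6 * (1 - z0) * (1 - r)" using b by simp
  \<comment> \<open>In the new parameters both factors of \<open>Y\<close> become products, which
    makes \<open>X = Y * z1\<close> solvable for \<open>B3\<close>.\<close>
  have "2 * b^2 - 3 * b + 3 * B2 = - 3 * b * (1 - z0) * r"
    unfolding B2 using br by algebra
  moreover have "b^2 + 2 * b + 2 * B2 = 2 * b * (1 + z0)"
    unfolding B2 by algebra
  ultimately have Y: "Y = - 18 * b^2 * (1 - z0^2) * r"
    unfolding Y_def by algebra
  have "18 * b * (B3 - b * ((b - (b * z0 - b^2 / 2)) / 18 + (z0 - b / 2)^2 + (1 - z0^2) * r * z1)) = 0"
    using X unfolding Y unfolding X_def B2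
    by (simp add: field_simps power2_eq_square power3_eq_cube)
  hence B3: "B3 = b * ((b - (b * z0 - b^2 / 2)) / 18 + (z0 - b / 2)^2 + (1 - z0^2) * r * z1)"
    using b by simp
  have "Y^2 - X^2 = 4 * b * D"
    unfolding X_def Y_def D_def by (rule sq_minus_sq_eq_D_poly)
  hence "4 * b * (D - 81 * b^3 * (1 - z0^2)^2 * r^2 * (1 - z1^2)) = 0"
    unfolding X Y by algebra
  hence D: "D = 81 * b^3 * (1 - z0^2)^2 * r^2 * (1 - z1^2)" using b by simp
  define g3 where "g3 = z0^2 + (1 - z0^2) * z1"
  define g4 where "g4 = z0^3 + 2 * z0 * (1 - z0^2) * z1 + (1 - z0^2) * (z2 * (1 - z1^2) - z0 * z1^2)"
  have B3': "B3 = b * ((b - B2) / 18 + (z0 - b / 2)^2 + (1 - z0^2) * r * z1)"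
    using B3 unfolding B2 .
  have "N_poly b B2 B3 B4 + 648 * b^3 * (1 - z0^2)^2 * r^2 * (1 - z1^2) * z2 = 0"
    using N unfolding N_def D by algebra
  with N_poly_eq[OF br, of B4 z1 z2, folded B2, folded B3', folded g3_def g4_def]
  have "648 * b^2 * (z0^2 - 1) * (B4 + 4 / 3 * b * B3 + B2^2 / 2 + b^2 * B2 + b^4 / 6
      - b * (1 - (1 - z0) * (2 * r + 1) + 3 * (1 - 2 * z0 + g3) * r - (1 - 3 * z0 + 3 * g3 - g4) * r^2)) = 0"
    by (rule trans)
  moreover have "z0^2 - 1 \<noteq> 0"
    using z0 abs_square_less_1[of z0] by linarith
  ultimately have e4: "B4 + 4 / 3 * b * B3 + B2^2 / 2 + b^2 * B2 + b^4 / 6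
      = b * (1 - (1 - z0) * (2 * r + 1) + 3 * (1 - 2 * z0 + g3) * r - (1 - 3 * z0 + 3 * g3 - g4) * r^2)"
    using b by simp
  \<comment> \<open>The matching equations contain only \<open>s^2\<close> and
    \<open>s^4\<close>.\<close>
  define s where "s = sqrt r"
  have s: "0 \<le> s" "s \<le> 1" "s^2 = r" using r by (simp_all add: s_def)
  have "s^4 = (s^2)^2" by (simp flip: power_mult)
  hence s4: "s^4 = r^2" by (simp only: s(3))
  show thesis
  proof (rule that[OF s(1,2) z0 z1 z2 g3_def g4_def])
    show "2 * B2 + 4 / 3 * b^2 = b * (2 - 2 * (1 - z0) * s^2)"
      unfolding s B2 using br by algebra
    show "B2 + b^2 / 2 = b * z0" by (simp add: B2)
    show "3 * B3 + 11 / 3 * b * B2 + b^3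
       = b * (3 - (1 - z0) * (4 * s^2 + 2) + 3 * (1 - 2 * z0 + g3) * s^2)"
      unfolding s B2 B3 g3_def br by algebra
    show "B4 + 4 / 3 * b * B3 + B2^2 / 2 + b^2 * B2 + b^4 / 6
       = b * (1 - (1 - z0) * (2 * s^2 + 1) + 3 * (1 - 2 * z0 + g3) * s^2
          - (1 - 3 * z0 + 3 * g3 - g4) * s^4)"
      unfolding s s4 by (rule e4)
  qed
qed

section \<open>The fifth coefficient in terms of the Schwarz function\<close>

lemma taylor_coeff_0_1:
  "taylor_coeff f 0 = f 0" "taylor_coeff f 1 = deriv f 0"
  by (simp_all add: fps_expansion_def)

lemma schwarz_function_schur_series:
  assumes "schwarz_function \<omega>"
  shows "schur_series (fps_expansion \<omega> 0)" "taylor_coeff \<omega> 0 = 0"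
proof -
  have hol: "\<omega> holomorphic_on unit_disc" using assms by (simp add: schwarz_function_def)
  have "norm (\<omega> z) \<le> 1" if "z \<in> unit_disc" for z
  proof -
    have "\<omega> z \<in> unit_disc" using assms that unfolding schwarz_function_def by blast
    thus ?thesis by simp
  qed
  thus "schur_series (fps_expansion \<omega> 0)"
    using schur_seriesI[OF hol _ has_fps_expansion_disc[OF hol]] by blast
  show "taylor_coeff \<omega> 0 = 0"
    using assms unfolding taylor_coeff_0_1 by (simp add: schwarz_function_def)
qed

text \<open>Clearing the denominator absorbs the removable singularity: at 0 both sides vanish
  because \<open>f 0 = 0\<close>.\<close>

lemma S_star_obtain:
  assumes "f \<in> S_star \<phi>"
  obtains \<omega> where "schwarz_function \<omega>"
    "\<And>z. z \<in> unit_disc \<Longrightarrow> z * deriv f z = f z * \<phi> (\<omega> z)"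
proof -
  obtain \<omega> where \<omega>: "schwarz_function \<omega>"
      "\<forall>z\<in>unit_disc. (if z = 0 then 1 else z * deriv f z / f z) = \<phi> (\<omega> z)"
    and nz: "\<forall>z\<in>unit_disc - {0}. f z \<noteq> 0" and "taylor_coeff f 0 = 0"
    using assms unfolding S_star_def class_A_def subordinate_def by blast
  hence f0: "f 0 = 0" by (simp only: taylor_coeff_0_1)
  have "z * deriv f z = f z * \<phi> (\<omega> z)" if z: "z \<in> unit_disc" for z
  proof (cases "z = 0")
    case False
    hence "f z \<noteq> 0" "z * deriv f z / f z = \<phi> (\<omega> z)" using bspec[OF \<omega>(2) z] bspec[OF nz, of z] z by simp_all
    thus ?thesis by (simp add: field_simps)
  qed (simp add: f0)
  with \<omega>(1) that show thesis by blast
qed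

text \<open>Coefficients are compared in \<open>z f' = f C\<close>, where \<open>C\<close> is the
  series of the composition, and the recursion is solved up to index 5. The product form of the
  hypothesis covers both arbitrary members and the extremal function.\<close>

lemma fifth_coeff_eq:
  assumes f: "f \<in> class_A" and \<phi>: "\<phi> holomorphic_on unit_disc" "\<phi> 0 = 1"
    and \<omega>: "schwarz_function \<omega>"
    and eq: "\<And>z. z \<in> unit_disc \<Longrightarrow> z * deriv f z = f z * \<phi> (\<omega> z)"
  shows "4 * taylor_coeff f 5 =
     taylor_coeff \<phi> 1 * taylor_coeff \<omega> 4
     + (2 * taylor_coeff \<phi> 2 + 4 / 3 * taylor_coeff \<phi> 1 ^ 2) * taylor_coeff \<omega> 1 * taylor_coeff \<omega> 3
     + (taylor_coeff \<phi> 2 + taylor_coeff \<phi> 1 ^ 2 / 2) * taylor_coeff \<omega> 2 ^ 2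
     + (3 * taylor_coeff \<phi> 3 + 11 / 3 * taylor_coeff \<phi> 1 * taylor_coeff \<phi> 2 + taylor_coeff \<phi> 1 ^ 3)
         * taylor_coeff \<omega> 1 ^ 2 * taylor_coeff \<omega> 2
     + (taylor_coeff \<phi> 4 + 4 / 3 * taylor_coeff \<phi> 1 * taylor_coeff \<phi> 3 + taylor_coeff \<phi> 2 ^ 2 / 2
         + taylor_coeff \<phi> 1 ^ 2 * taylor_coeff \<phi> 2 + taylor_coeff \<phi> 1 ^ 4 / 6) * taylor_coeff \<omega> 1 ^ 4"
proof -
  define A where "A = fps_expansion f 0"
  define \<Phi> where "\<Phi> = fps_expansion \<phi> 0"
  define F where "F = fps_expansion \<omega> 0"
  define C where "C = fps_compose \<Phi> F"
  have F0: "fps_nth F 0 = 0"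
    unfolding F_def by (rule schwarz_function_schur_series[OF \<omega>])
  have holf: "f holomorphic_on unit_disc" and A0: "fps_nth A 0 = 0" and A1: "fps_nth A 1 = 1"
    using f by (simp_all only: class_A_def A_def mem_Collect_eq)
  have ef: "f has_fps_expansion A"
    unfolding A_def by (rule has_fps_expansion_disc[OF holf])
  have e\<phi>: "\<phi> has_fps_expansion \<Phi>"
    unfolding \<Phi>_def by (rule has_fps_expansion_disc[OF \<phi>(1)])
  have e\<omega>: "\<omega> has_fps_expansion F"
    unfolding F_def using \<omega> by (intro has_fps_expansion_disc) (simp add: schwarz_function_def)
  have \<Phi>0: "fps_nth \<Phi> 0 = 1" unfolding \<Phi>_def taylor_coeff_0_1 by (rule \<phi>)
  have "(\<lambda>z. z * deriv f z) has_fps_expansion fps_X * fps_deriv A"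
    by (intro fps_expansion_intros ef)
  moreover have "(\<phi> \<circ> \<omega>) has_fps_expansion C"
    unfolding C_def by (rule has_fps_expansion_compose[OF e\<phi> e\<omega> F0])
  hence "(\<lambda>z. f z * (\<phi> \<circ> \<omega>) z) has_fps_expansion A * C"
    by (intro fps_expansion_intros ef)
  ultimately have XA: "fps_X * fps_deriv A = A * C"
    by (rule has_fps_expansion_eqI_disc) (simp add: eq)
  have An: "of_nat n * fps_nth A n = fps_nth (A * C) n" for n
    using arg_cong[OF XA, of "\<lambda>B. fps_nth B n"] by (cases n) auto
  have C0: "fps_nth C 0 = 1" by (simp add: C_def \<Phi>0)
  have C1: "fps_nth C 1 = fps_nth \<Phi> 1 * fps_nth F 1"
    using F0 by (simp add: C_def fps_compose_nth)
  have C2: "fps_nth C 2 = fps_nth \<Phi> 1 * fps_nth F 2 + fps_nth \<Phi> 2 * fps_nth F 1 ^ 2"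
    using F0 by (simp add: C_def fps_compose_nth fps_mult_nth numeral_eq_Suc)
  have C3: "fps_nth C 3 = fps_nth \<Phi> 1 * fps_nth F 3 + fps_nth \<Phi> 2 * (2 * fps_nth F 1 * fps_nth F 2)
      + fps_nth \<Phi> 3 * fps_nth F 1 ^ 3"
    using F0 by (simp add: C_def fps_compose_nth fps_mult_nth numeral_eq_Suc algebra_simps)
  have C4: "fps_nth C 4 = fps_nth \<Phi> 1 * fps_nth F 4
      + fps_nth \<Phi> 2 * (2 * fps_nth F 1 * fps_nth F 3 + fps_nth F 2 ^ 2)
      + fps_nth \<Phi> 3 * (3 * fps_nth F 1 ^ 2 * fps_nth F 2) + fps_nth \<Phi> 4 * fps_nth F 1 ^ 4"
    using F0 by (simp add: C_def fps_compose_nth fps_mult_nth numeral_eq_Suc algebra_simps)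
  have A2: "fps_nth A 2 = fps_nth C 1"
    using An[of 2] A0 A1 C0 by (simp add: fps_mult_nth numeral_eq_Suc algebra_simps)
  have A3: "2 * fps_nth A 3 = fps_nth C 2 + fps_nth A 2 * fps_nth C 1"
    using An[of 3] A0 A1 C0 by (simp add: fps_mult_nth numeral_eq_Suc algebra_simps)
  have A4: "3 * fps_nth A 4 = fps_nth C 3 + fps_nth A 2 * fps_nth C 2 + fps_nth A 3 * fps_nth C 1"
    using An[of 4] A0 A1 C0 by (simp add: fps_mult_nth numeral_eq_Suc algebra_simps)
  have A5: "4 * fps_nth A 5 = fps_nth C 4 + fps_nth A 2 * fps_nth C 3 + fps_nth A 3 * fps_nth C 2
      + fps_nth A 4 * fps_nth C 1"
    using An[of 5] A0 A1 C0 by (simp add: fps_mult_nth numeral_eq_Suc algebra_simps)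
  have A3': "fps_nth A 3 = (fps_nth C 2 + fps_nth C 1 ^ 2) / 2"
    using A3 A2 by (simp add: field_simps power2_eq_square)
  have A4': "fps_nth A 4 = (fps_nth C 3 + fps_nth C 1 * fps_nth C 2 + fps_nth A 3 * fps_nth C 1) / 3"
    using A4 A2 by (simp add: field_simps)
  \<comment> \<open>The same polynomial in the coefficients of \<open>\<phi>\<close> reappears as
    the factor of \<open>taylor_coeff \<omega> 1 ^ 4\<close>.\<close>
  have "4 * fps_nth A 5 = fps_nth C 4 + 4 / 3 * fps_nth C 1 * fps_nth C 3 + fps_nth C 2 ^ 2 / 2
      + fps_nth C 1 ^ 2 * fps_nth C 2 + fps_nth C 1 ^ 4 / 6"
    unfolding A5 A4' A3' A2 by (simp add: field_simps power2_eq_square power4_eq_xxxx)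
  thus ?thesis
    unfolding C1 C2 C3 C4 A_def[symmetric] \<Phi>_def[symmetric] F_def[symmetric]
    by algebra
qed

section \<open>The extremal function and the final estimate\<close>

lemma schwarz_function_z4: "schwarz_function (\<lambda>z. z ^ 4)"
  by (auto simp: schwarz_function_def norm_power power_less_one_iff intro!: holomorphic_intros)

text \<open>The differential equation is solved explicitly by \<open>z\<close> times the exponential
  of a primitive of \<open>(\<phi> (z ^ 4) - 1) / z\<close>.\<close>

lemma S_star_member_z4:
  assumes "\<phi> holomorphic_on unit_disc" "\<phi> 0 = 1"
  obtains f where "f \<in> S_star \<phi>"
    "\<And>z. z \<in> unit_disc \<Longrightarrow> z * deriv f z = f z * \<phi> (z ^ 4)"
proof -
  have "(\<phi> \<circ> (\<lambda>z. z ^ 4)) holomorphic_on unit_disc"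
    by (rule holomorphic_on_compose_gen[OF _ assms(1)]) (use schwarz_function_z4 in \<open>auto simp: schwarz_function_def\<close>)
  hence hol: "(\<lambda>z. \<phi> (z ^ 4)) holomorphic_on unit_disc" by (simp add: o_def)
  obtain h where h: "h holomorphic_on unit_disc" "\<And>z. norm z < 1 \<Longrightarrow> \<phi> (z ^ 4) - 1 = z * h z"
  proof (rule Schwarz3)
    show "(\<lambda>z. \<phi> (z ^ 4) - 1) holomorphic_on unit_disc"
      by (intro holomorphic_intros hol)
  qed (use assms(2) in auto)
  obtain g where g: "\<And>z. z \<in> unit_disc \<Longrightarrow> (g has_field_derivative h z) (at z within unit_disc)"
    using holomorphic_convex_primitive'[OF convex_ball open_ball h(1)] by blast
  have gD: "(g has_field_derivative h z) (at z)" if "z \<in> unit_disc" for z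
    using g[OF that] at_within_open[OF that open_ball] by simp
  \<comment> \<open>Subtracting \<open>g 0\<close> normalises the derivative at 0 to 1, and the
    exponential ensures that 0 is the only zero.\<close>
  define f where "f z = z * exp (g z - g 0)" for z
  have fD: "(f has_field_derivative exp (g z - g 0) * \<phi> (z ^ 4)) (at z)" if "z \<in> unit_disc" for z
  proof -
    have "(f has_field_derivative exp (g z - g 0) * (1 + z * h z)) (at z)"
      unfolding f_def by (auto intro!: derivative_eq_intros gD[OF that] simp: algebra_simps)
    thus ?thesis using h(2)[of z] that by (simp add: algebra_simps)
  qed
  have deriv: "deriv f z = exp (g z - g 0) * \<phi> (z ^ 4)" if "z \<in> unit_disc" for z
    by (rule DERIV_imp_deriv[OF fD[OF that]])
  have holf: "f holomorphic_on unit_disc"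
    unfolding holomorphic_on_open[OF open_ball] using fD by blast
  have A: "f \<in> class_A"
    unfolding class_A_def mem_Collect_eq taylor_coeff_0_1
    using holf deriv[of 0] by (simp add: f_def assms(2))
  have q: "(if z = 0 then 1 else z * deriv f z / f z) = \<phi> (z ^ 4)" if "z \<in> unit_disc" for z
    using deriv[OF that] assms(2) by (simp add: f_def)
  have "(\<lambda>z. if z = 0 then 1 else z * deriv f z / f z) holomorphic_on unit_disc"
    by (rule holomorphic_transform[OF hol]) (simp add: q)
  hence "subordinate (\<lambda>z. if z = 0 then 1 else z * deriv f z / f z) \<phi>"
    unfolding subordinate_def using assms(1) q schwarz_function_z4 by blast
  hence "f \<in> S_star \<phi>"
    using A by (simp add: S_star_def f_def)
  moreover have "z * deriv f z = f z * \<phi> (z ^ 4)" if "z \<in> unit_disc" for z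
    using deriv[OF that] by (simp add: f_def)
  ultimately show thesis by (rule that)
qed

theorem theorem5:
  fixes \<phi> :: "complex \<Rightarrow> complex" and B :: "nat \<Rightarrow> real"
  assumes "ma_minda \<phi>"
    and "\<And>n. B n = Re (taylor_coeff \<phi> n)"
    and "\<bar>(B 1)^2 + 2 * B 2\<bar> < 2 * B 1"
    and "\<bar>(B 1)^3 - (B 1)^2 * B 2 + 18 * (B 2)^2 - 18 * B 1 * B 3\<bar>
         < 3 * \<bar>((B 1)^2 + 2 * B 1 + 2 * B 2) * (2 * (B 1)^2 - 3 * B 1 + 3 * B 2)\<bar>"
    and "\<bar>N_poly (B 1) (B 2) (B 3) (B 4)\<bar> < 8 * \<bar>D_poly (B 1) (B 2) (B 3)\<bar>"
    and "0 < (4 * (B 1)^2 + 6 * (B 2 - B 1)) / (3 * (B 1)^2 + 6 * (B 2 - B 1))"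
    and "(4 * (B 1)^2 + 6 * (B 2 - B 1)) / (3 * (B 1)^2 + 6 * (B 2 - B 1)) < 1"
  shows "(\<forall>f\<in>S_star \<phi>. norm (taylor_coeff f 5) \<le> B 1 / 4) \<and>
         (\<exists>f\<in>S_star \<phi>. norm (taylor_coeff f 5) = B 1 / 4)"
proof
  have \<phi>: "\<phi> holomorphic_on unit_disc" "\<phi> 0 = 1" and "Re (deriv \<phi> 0) > 0"
    using assms(1) by (auto simp: ma_minda_def)
  hence B1: "B 1 > 0" by (simp only: assms(2) taylor_coeff_0_1)
  have c: "taylor_coeff \<phi> n = of_real (B n)" for n
    unfolding assms(2) by (rule ma_minda_taylor_coeff_real[OF assms(1), symmetric])
  show "\<forall>f\<in>S_star \<phi>. norm (taylor_coeff f 5) \<le> B 1 / 4"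
  proof
    fix f assume f: "f \<in> S_star \<phi>"
    then obtain \<omega> where \<omega>: "schwarz_function \<omega>"
        "\<And>z. z \<in> unit_disc \<Longrightarrow> z * deriv f z = f z * \<phi> (\<omega> z)"
      using S_star_obtain by blast
    have A: "f \<in> class_A" using f by (simp add: S_star_def)
    obtain s z0 z1 z2 g3 g4 where s: "0 \<le> s" "s \<le> 1"
      and z: "\<bar>z0\<bar> < 1" "\<bar>z1\<bar> < 1" "\<bar>z2\<bar> < 1"
      and g: "g3 = z0^2 + (1 - z0^2) * z1"
        "g4 = z0^3 + 2 * z0 * (1 - z0^2) * z1 + (1 - z0^2) * (z2 * (1 - z1^2) - z0 * z1^2)"
      and q: "2 * B 2 + 4 / 3 * B 1^2 = B 1 * (2 - 2 * (1 - z0) * s^2)"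
        "B 2 + B 1^2 / 2 = B 1 * z0"
        "3 * B 3 + 11 / 3 * B 1 * B 2 + B 1^3
           = B 1 * (3 - (1 - z0) * (4 * s^2 + 2) + 3 * (1 - 2 * z0 + g3) * s^2)"
        "B 4 + 4 / 3 * B 1 * B 3 + B 2^2 / 2 + B 1^2 * B 2 + B 1^4 / 6
           = B 1 * (1 - (1 - z0) * (2 * s^2 + 1) + 3 * (1 - 2 * z0 + g3) * s^2
              - (1 - 3 * z0 + 3 * g3 - g4) * s^4)"
      using schur_parameters_of_coeffs[OF assms(3-7)] by blast
    define E where "E = taylor_coeff \<omega> 4
      + of_real (2 - 2 * (1 - z0) * s^2) * taylor_coeff \<omega> 1 * taylor_coeff \<omega> 3
      + of_real z0 * (taylor_coeff \<omega> 2)^2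
      + of_real (3 - (1 - z0) * (4 * s^2 + 2) + 3 * (1 - 2 * z0 + g3) * s^2)
          * (taylor_coeff \<omega> 1)^2 * taylor_coeff \<omega> 2
      + of_real (1 - (1 - z0) * (2 * s^2 + 1) + 3 * (1 - 2 * z0 + g3) * s^2
          - (1 - 3 * z0 + 3 * g3 - g4) * s^4) * (taylor_coeff \<omega> 1)^4"
    have "4 * taylor_coeff f 5 = of_real (B 1) * taylor_coeff \<omega> 4
      + of_real (2 * B 2 + 4 / 3 * B 1^2) * taylor_coeff \<omega> 1 * taylor_coeff \<omega> 3
      + of_real (B 2 + B 1^2 / 2) * (taylor_coeff \<omega> 2)^2
      + of_real (3 * B 3 + 11 / 3 * B 1 * B 2 + B 1^3) * (taylor_coeff \<omega> 1)^2 * taylor_coeff \<omega> 2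
      + of_real (B 4 + 4 / 3 * B 1 * B 3 + B 2^2 / 2 + B 1^2 * B 2 + B 1^4 / 6) * (taylor_coeff \<omega> 1)^4"
      using fifth_coeff_eq[OF A \<phi> \<omega>] unfolding c by simp
    \<comment> \<open>The equations \<open>q\<close> make every coefficient a multiple of
      \<open>B 1\<close>.\<close>
    also have "\<dots> = of_real (B 1) * E"
      unfolding q E_def of_real_mult by (simp only: distrib_left mult.assoc)
    finally have "norm (4 * taylor_coeff f 5) = B 1 * norm E"
      using B1 by (simp only: norm_mult norm_of_real abs_of_pos)
    moreover have "norm E \<le> 1"
      unfolding E_def g
      by (rule schur_fourth_coeff_bound[OF schwarz_function_schur_series[OF \<omega>(1)] s z])
    hence "B 1 * norm E \<le> B 1" using B1 by simp
    ultimately show "norm (taylor_coeff f 5) \<le> B 1 / 4"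
      by (simp add: norm_mult)
  qed
  obtain f where f: "f \<in> S_star \<phi>" "\<And>z. z \<in> unit_disc \<Longrightarrow> z * deriv f z = f z * \<phi> (z ^ 4)"
    using S_star_member_z4[OF \<phi>] by blast
  have A: "f \<in> class_A" using f(1) by (simp add: S_star_def)
  have "(\<lambda>z::complex. z ^ 4) has_fps_expansion fps_X ^ 4"
    by (rule has_fps_expansion_fps_X_power)
  hence e: "fps_expansion (\<lambda>z::complex. z ^ 4) 0 = fps_X ^ 4"
    by (rule fps_expansion_eqI)
  \<comment> \<open>For \<open>z ^ 4\<close> the first three coefficients vanish and the fourth is
    1, so only the leading term survives.\<close>
  have "4 * taylor_coeff f 5 = of_real (B 1)"
    using fifth_coeff_eq[OF A \<phi> schwarz_function_z4 f(2)] unfolding e c by (simp add: fps_X_power_nth)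
  hence "norm (4 * taylor_coeff f 5) = B 1" using B1 by simp
  hence "norm (taylor_coeff f 5) = B 1 / 4" by (simp add: norm_mult)
  thus "\<exists>f\<in>S_star \<phi>. norm (taylor_coeff f 5) = B 1 / 4"
    using f(1) by blast
qed

end
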